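(* Let $X$ be a metric space and let $\nu,\nu_1,\nu_2,\dots\in\mathcal{M}(X)$ be Borel probability measures such that $\nu_n\to\nu$ setwisely as $n\to\infty$. Then $$\limsup_{n\to\infty}\dim_H^0\nu_n\ \le\ \dim_H^0\nu .$$
   Context: $\mathcal{M}(X)$ is the set of all probability measures on $(X,\mathscr{A})$, where $\mathscr{A}$ is the Borel $\sigma$-algebra of the metric space $X$. $HD(A)$ denotes the Hausdorff dimension of $A\subset X$. The lower measure-dimension mapping is $$\dim_H^0\nu=\inf\{HD(A):\ A\in\mathscr{A},\ \nu(A)>0\}.$$ A sequence $\nu_n\in\mathcal{M}(X)$ converges setwisely to $\nu\in\mathcal{M}(X)$ if $\lim_{n\to\infty}\nu_n(A)=\nu(A)$ for every $A\in\mathscr{A}$. *)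

theory Defs
  imports "HOL-Probability.Probability"
begin

(* The convention diam(U)^0 = 1 for nonempty U (so that the 0-dimensional measure counts points)
   has to be spelled out, since 0 powr 0 = 0. *)
definition diam_pow :: "real \<Rightarrow> 'a::metric_space set \<Rightarrow> ennreal" where
  "diam_pow s U =
     (if U = {} then 0 else if s = 0 then 1 else ennreal (diameter U powr s))"

(* Covers are sequences; finite covers are included because members may be empty.
   Boundedness is required explicitly, as diameter is unspecified on unbounded sets.
   If no such cover exists (possible in a non-separable space), the infimum is infinite. *)
definition hausdorff_premeasure :: "real \<Rightarrow> real \<Rightarrow> 'a::metric_space set \<Rightarrow> ennreal" where
  "hausdorff_premeasure s \<delta> A =
     (INF U \<in> {U :: nat \<Rightarrow> 'a set.
                A \<subseteq> (\<Union>i. U i) \<and> (\<forall>i. bounded (U i) \<and> diameter (U i) \<le> \<delta>)}.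
        (\<Sum>i. diam_pow s (U i)))"

definition hausdorff_measure :: "real \<Rightarrow> 'a::metric_space set \<Rightarrow> ennreal" where
  "hausdorff_measure s A = (SUP \<delta>\<in>{0<..}. hausdorff_premeasure s \<delta> A)"

(* Extended-valued: the infimum of the empty set is infinite. *)
definition hausdorff_dim :: "'a::metric_space set \<Rightarrow> ennreal" where
  "hausdorff_dim A = (INF s \<in> {s. 0 \<le> s \<and> hausdorff_measure s A = 0}. ennreal s)"

definition borel_prob_measures :: "'a::metric_space measure set" where
  "borel_prob_measures = {\<nu>. prob_space \<nu> \<and> sets \<nu> = sets borel}"

definition lower_measure_dim :: "'a::metric_space measure \<Rightarrow> ennreal" where
  "lower_measure_dim \<nu> = (INF A \<in> {A \<in> sets borel. measure \<nu> A > 0}. hausdorff_dim A)"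

definition setwise_converges ::
    "(nat \<Rightarrow> 'a::metric_space measure) \<Rightarrow> 'a measure \<Rightarrow> bool" where
  "setwise_converges \<nu>s \<nu> \<longleftrightarrow>
     (\<forall>A \<in> sets borel. (\<lambda>n. measure (\<nu>s n) A) \<longlonglongrightarrow> measure \<nu> A)"

end

theory Submission
  imports Defs
begin

text \<open>
  Setwise convergence preserves positivity along the tail of the sequence: a Borel set charged by
  the limit \<open>\<nu>\<close> is charged by all but finitely many of the \<open>\<nu>\<^sub>n\<close>. It is then a competitor in the
  infimum defining the lower dimension of those \<open>\<nu>\<^sub>n\<close>, so its Hausdorff dimension bounds the limit
  superior.
\<close>

theorem theorem2p5:
  fixes \<nu> :: "'a::metric_space measure" and \<nu>s :: "nat \<Rightarrow> 'a measure"
  assumes "\<nu> \<in> borel_prob_measures"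
    and "\<And>n. \<nu>s n \<in> borel_prob_measures"
    and "setwise_converges \<nu>s \<nu>"
  shows "limsup (\<lambda>n. lower_measure_dim (\<nu>s n)) \<le> lower_measure_dim \<nu>"
  unfolding lower_measure_dim_def[of \<nu>]
proof (rule INF_greatest)
  fix A :: "'a set"
  assume "A \<in> {A \<in> sets borel. measure \<nu> A > 0}"
  then have A: "A \<in> sets borel" and pos: "measure \<nu> A > 0"
    by auto
  from A assms(3) have "(\<lambda>n. measure (\<nu>s n) A) \<longlonglongrightarrow> measure \<nu> A"
    by (simp add: setwise_converges_def)
  then have "\<forall>\<^sub>F n in sequentially. measure (\<nu>s n) A > 0"
    using pos by (rule order_tendstoD(1))
  then have "\<forall>\<^sub>F n in sequentially. lower_measure_dim (\<nu>s n) \<le> hausdorff_dim A"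
    by (rule eventually_mono) (auto simp: lower_measure_dim_def A intro: INF_lower)
  then show "limsup (\<lambda>n. lower_measure_dim (\<nu>s n)) \<le> hausdorff_dim A"
    by (rule Limsup_bounded)
qed

end
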